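(* Let $\mathbb{F}$ be a field, let $n\geq 1$, and let $A\in \mathrm{Mat}_n(\mathbb{F})$. If $\Lambda=\begin{bmatrix} p&q\\ r&s\end{bmatrix}\in \mathrm{Mat}_2(\mathbb{F})$ is a super-eigenvalue of $A$, then $$\det\big((A-pI_n)(A-sI_n)-qrI_n\big)=0.$$
   Context: Let $\mathbb{F}$ be a field and $A\in \mathrm{Mat}_n(\mathbb{F})$, acting on column vectors in $\mathbb{F}^n$. A super-eigenvector of $A$ is a $2$-dimensional $A$-invariant subspace $W\subseteq \mathbb{F}^n$. If $W=\langle \mathbf{u},\mathbf{v}\rangle$ is a super-eigenvector with basis $\mathbf{u},\mathbf{v}$ and $A\mathbf{u}=p\mathbf{u}+q\mathbf{v}$, $A\mathbf{v}=r\mathbf{u}+s\mathbf{v}$ with $p,q,r,s\in\mathbb{F}$, then $\Lambda=\begin{bmatrix} p&q\\ r&s\end{bmatrix}$ is called a super-eigenvalue of $A$ corresponding to $W$. *)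

theory Defs
  imports "HOL-Analysis.Analysis"
begin

definition super_eigenvector :: "'a::field ^ 'n ^ 'n \<Rightarrow> ('a ^ 'n) set \<Rightarrow> bool" where
  "super_eigenvector A W \<longleftrightarrow>
     vec.subspace W \<and> vec.dim W = 2 \<and> (\<forall>x\<in>W. A *v x \<in> W)"

(* The rows of L hold the coordinates of A u and A v, so L is the transpose of the
   usual matrix of A restricted to W. The condition u \<noteq> v is needed because the set
   {u, v} would otherwise collapse to a singleton. *)
definition super_eigenvalue_for ::
    "'a::field ^ 'n ^ 'n \<Rightarrow> ('a ^ 'n) set \<Rightarrow> 'a ^ 2 ^ 2 \<Rightarrow> bool" where
  "super_eigenvalue_for A W L \<longleftrightarrow>
     super_eigenvector A W \<and>
     (\<exists>u v. u \<noteq> v \<and> vec.independent {u, v} \<and> vec.span {u, v} = W \<and>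
        A *v u = L $ 1 $ 1 *s u + L $ 1 $ 2 *s v \<and>
        A *v v = L $ 2 $ 1 *s u + L $ 2 $ 2 *s v)"

definition super_eigenvalue :: "'a::field ^ 'n ^ 'n \<Rightarrow> 'a ^ 2 ^ 2 \<Rightarrow> bool" where
  "super_eigenvalue A L \<longleftrightarrow> (\<exists>W. super_eigenvalue_for A W L)"

end

theory Submission
  imports Defs
begin

text \<open>The basis vector \<open>v\<close> of the invariant plane lies in the kernel of the
  matrix in question. The relations for \<open>A *v u\<close> and \<open>A *v v\<close> say that A -
  sI sends \<open>v\<close> to r u and A - pI sends \<open>u\<close> to q v, so the product sends
  \<open>v\<close> to qr v. Since \<open>v\<close> is nonzero by independence, the determinant
  vanishes by \<open>det_eq_0_if_kernel_vector\<close>.\<close>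

text \<open>A nonzero determinant would give a left inverse, forcing a trivial kernel.\<close>

lemma det_eq_0_if_kernel_vector:
  fixes M :: "'a::field ^ 'n ^ 'n"
  assumes "M *v x = 0" and "x \<noteq> 0"
  shows "det M = 0"
  using assms invertible_det_nz[of M] matrix_left_invertible_ker[of M]
  unfolding invertible_def by blast

lemma mat_vector_mult:
  fixes c :: "'a::field"
  shows "mat c *v x = c *s (x :: 'a ^ 'n)"
proof -
  have "(\<Sum>j\<in>UNIV. (if i = j then c else 0) * x $ j) = c * x $ i" for i
    by (simp add: if_distrib[where f = "\<lambda>y. y * _"] cong: if_cong)
  then show ?thesis
    by (simp add: vec_eq_iff matrix_vector_mult_def mat_def)
qed

theorem proposition3p3:
  fixes A :: "'a::field ^ 'n ^ 'n" and p q r s :: 'a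
  assumes "super_eigenvalue A (vector [vector [p, q], vector [r, s]])"
  shows "det ((A - mat p) ** (A - mat s) - mat (q * r)) = 0"
proof -
  obtain u v where indep: "vec.independent {u, v}"
    and Au: "A *v u = p *s u + q *s v" and Av: "A *v v = r *s u + s *s v"
    using assms by (auto simp: super_eigenvalue_def super_eigenvalue_for_def)
  have "v \<noteq> 0"
    using indep vec.dependent_zero[of "{u, v}"] by auto
  have pu: "(A - mat p) *v u = q *s v" and sv: "(A - mat s) *v v = r *s u"
    by (simp_all add: matrix_vector_mult_diff_rdistrib mat_vector_mult Au Av)
  \<comment> \<open>Testing on \<open>v\<close> rather than \<open>u\<close> suits the order of the
    factors: A - sI acts first.\<close>
  have "((A - mat p) ** (A - mat s) - mat (q * r)) *v v
      = (A - mat p) *v (r *s u) - (q * r) *s v"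
    \<comment> \<open>The instantiation splits only the outer difference; splitting
      \<open>A - mat s\<close> too would keep \<open>sv\<close> from applying.\<close>
    by (simp only: matrix_vector_mult_diff_rdistrib[of "(A - mat p) ** (A - mat s)"]
        mat_vector_mult sv flip: matrix_vector_mul_assoc)
  also have "\<dots> = 0"
    by (simp only: vec.scale pu) (simp add: mult.commute)
  finally show ?thesis
    using \<open>v \<noteq> 0\<close> by (rule det_eq_0_if_kernel_vector)
qed

end
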